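(* Let $n\ge 3$ be an integer, let $\Gamma_{D_{2n}}$ be the non-commuting graph of the dihedral group $D_{2n}$ of order $2n$, and let $L(\Gamma_{D_{2n}})$ be its Laplacian matrix. Write spectra as two-row arrays with eigenvalues in the first row and their multiplicities in the second row. (1) If $n$ is even and $n>4$, then $$\mathrm{spec}(L(\Gamma_{D_{2n}}))=\begin{pmatrix} 2n-2 & 2n-4 & n & 0\\ \frac n2 & \frac n2 & n-3 & 1\end{pmatrix}.$$ (2) If $n$ is odd, then $$\mathrm{spec}(L(\Gamma_{D_{2n}}))=\begin{pmatrix} 0 & n & 2n-1\\ 1 & n-2 & n\end{pmatrix}.$$ (3) If $n=4$, then $$\mathrm{spec}(L(\Gamma_{D_{2n}}))=\begin{pmatrix} 0 & 4 & 6\\ 1 & 3 & 2\end{pmatrix}.$$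
   Context: For a finite non-abelian group $G$ with center $Z(G)$, the non-commuting graph $\Gamma_G=\Gamma(G)$ is the simple graph with vertex set $G\setminus Z(G)$ in which two vertices $x,y$ are adjacent if and only if $xy\ne yx$. The Laplacian matrix of a graph is $L=D-A$, where $A$ is the adjacency matrix and $D$ is the diagonal matrix of vertex degrees; $\mathrm{spec}(L)$ is the multiset of eigenvalues of $L$ with multiplicities. *)

theory Defs
  imports
    Complex_Main
    "HOL-Library.Multiset"
    "HOL-Algebra.Coset"
    "HOL-Computational_Algebra.Fundamental_Theorem_Algebra"
    "Jordan_Normal_Form.Char_Poly"
    "Jordan_Normal_Form.Spectral_Radius"
    "Graph_Theory.Pair_Digraph"
begin

text \<open>The pair \<open>(i, b)\<close> stands for \<open>r\<^sup>i s\<^sup>b\<close> (with \<open>s\<^sup>b = s\<close> for \<open>b = True\<close> and the identity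
  otherwise), where \<open>r\<^sup>n = s\<^sup>2 = 1\<close> and \<open>s r = r\<^sup>-\<^sup>1 s\<close>; hence
  \<open>r\<^sup>i s \<cdot> r\<^sup>j s\<^sup>c = r\<^sup>(\<^sup>i\<^sup>-\<^sup>j\<^sup>) s s\<^sup>c\<close>.\<close>

definition dihedral_group :: "nat \<Rightarrow> (int \<times> bool) monoid" where
  "dihedral_group n =
     \<lparr> carrier = {0..<int n} \<times> UNIV,
       monoid.mult = (\<lambda>(i, b) (j, c). ((if b then i - j else i + j) mod int n, b \<noteq> c)),
       one = (0, False) \<rparr>"

definition center :: "('a, 'b) monoid_scheme \<Rightarrow> 'a set" where
  "center G = {z \<in> carrier G. \<forall>g \<in> carrier G. z \<otimes>\<^bsub>G\<^esub> g = g \<otimes>\<^bsub>G\<^esub> z}"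

text \<open>A simple graph is a digraph whose arc relation is symmetric and irreflexive
  (the locale \<^locale>\<open>pair_graph\<close>); the degree of a vertex is then its out-degree.\<close>

definition non_commuting_graph :: "('a, 'b) monoid_scheme \<Rightarrow> 'a pair_pre_digraph" where
  "non_commuting_graph G =
     \<lparr> pverts = carrier G - center G,
       parcs = {(x, y). x \<in> carrier G - center G \<and> y \<in> carrier G - center G \<and>
                        x \<otimes>\<^bsub>G\<^esub> y \<noteq> y \<otimes>\<^bsub>G\<^esub> x} \<rparr>"

text \<open>Matrices of a graph are taken with respect to a list enumerating its vertices.\<close>

definition vertex_enumeration :: "'a pair_pre_digraph \<Rightarrow> 'a list \<Rightarrow> bool" where
  "vertex_enumeration \<Gamma> vs \<longleftrightarrow> distinct vs \<and> set vs = pverts \<Gamma>"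

definition adjacency_mat :: "'a pair_pre_digraph \<Rightarrow> 'a list \<Rightarrow> real mat" where
  "adjacency_mat \<Gamma> vs = mat (length vs) (length vs)
     (\<lambda>(i, j). if (vs ! i, vs ! j) \<in> parcs \<Gamma> then 1 else 0)"

definition degree_mat :: "'a pair_pre_digraph \<Rightarrow> 'a list \<Rightarrow> real mat" where
  "degree_mat \<Gamma> vs = mat (length vs) (length vs)
     (\<lambda>(i, j). if i = j then real (out_degree (with_proj \<Gamma>) (vs ! i)) else 0)"

definition laplacian_mat :: "'a pair_pre_digraph \<Rightarrow> 'a list \<Rightarrow> real mat" where
  "laplacian_mat \<Gamma> vs = degree_mat \<Gamma> vs - adjacency_mat \<Gamma> vs"

text \<open>The eigenvalues are taken in the complex numbers, so that no part of the spectrum can be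
  lost; the multiplicity is that of the root of the characteristic polynomial.\<close>

definition spec :: "real mat \<Rightarrow> complex multiset" where
  "spec A = proots (char_poly (map_mat complex_of_real A))"

lemma set_mset_spec:
  assumes "A \<in> carrier_mat k k"
  shows "set_mset (spec A) = spectrum (map_mat complex_of_real A)"
proof -
  have A: "map_mat complex_of_real A \<in> carrier_mat k k" using assms by simp
  have "char_poly (map_mat complex_of_real A) \<noteq> 0"
    using degree_monic_char_poly[OF A] by auto
  then show ?thesis
    unfolding spec_def spectrum_root_char_poly[OF A] by simp
qed

lemma size_spec:
  assumes "A \<in> carrier_mat k k"
  shows "size (spec A) = k"
  unfolding spec_def size_proots_complex
  using degree_monic_char_poly[of "map_mat complex_of_real A" k] assms by simp

lemma pair_graph_non_commuting_graph:
  assumes "finite (carrier G)"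
  shows "pair_graph (non_commuting_graph G)"
proof -
  have "finite (parcs (non_commuting_graph G))"
    by (rule finite_subset[of _ "carrier G \<times> carrier G"])
      (use assms in \<open>auto simp: non_commuting_graph_def\<close>)
  then show ?thesis
    using assms
    by unfold_locales
      (auto simp: non_commuting_graph_def symmetric_def sym_def)
qed

lemma group_dihedral_group:
  assumes "n \<ge> 1"
  shows "group (dihedral_group n)"
proof (rule groupI)
  fix x y z
  assume "x \<in> carrier (dihedral_group n)" "y \<in> carrier (dihedral_group n)"
    "z \<in> carrier (dihedral_group n)"
  then show "x \<otimes>\<^bsub>dihedral_group n\<^esub> y \<otimes>\<^bsub>dihedral_group n\<^esub> z =
      x \<otimes>\<^bsub>dihedral_group n\<^esub> (y \<otimes>\<^bsub>dihedral_group n\<^esub> z)"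
    by (auto simp: dihedral_group_def mod_simps algebra_simps)
next
  fix x
  assume x: "x \<in> carrier (dihedral_group n)"
  obtain i b where [simp]: "x = (i, b)" by (cases x)
  show "\<exists>y \<in> carrier (dihedral_group n). y \<otimes>\<^bsub>dihedral_group n\<^esub> x = \<one>\<^bsub>dihedral_group n\<^esub>"
    using x assms
    by (intro bexI[of _ "(if b then i else (- i) mod int n, b)"])
      (auto simp: dihedral_group_def mod_simps)
qed (use assms in \<open>auto simp: dihedral_group_def\<close>)

lemma order_dihedral_group: "Coset.order (dihedral_group n) = 2 * n"
  by (simp add: Coset.order_def dihedral_group_def card_cartesian_product)

lemma dihedral_group_rotation_pow:
  assumes "n \<ge> 2"
  shows "(1, False) [^]\<^bsub>dihedral_group n\<^esub> (k::nat) = (int k mod int n, False)"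
proof (induction k)
  case 0
  then show ?case by (simp add: dihedral_group_def nat_pow_def)
next
  case (Suc k)
  have "(1, False) [^]\<^bsub>dihedral_group n\<^esub> (Suc k) =
      (1, False) [^]\<^bsub>dihedral_group n\<^esub> k \<otimes>\<^bsub>dihedral_group n\<^esub> (1, False)"
    by (simp add: nat_pow_def)
  with Suc show ?case by (simp add: dihedral_group_def mod_simps add.commute)
qed

lemma dihedral_group_relations:
  assumes "n \<ge> 2"
  defines "D \<equiv> dihedral_group n"
  defines "r \<equiv> (1, False)" and "s \<equiv> (0, True)"
  shows "r \<in> carrier D" "s \<in> carrier D"
    and "r [^]\<^bsub>D\<^esub> n = \<one>\<^bsub>D\<^esub>" "s \<otimes>\<^bsub>D\<^esub> s = \<one>\<^bsub>D\<^esub>"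
    and "(s \<otimes>\<^bsub>D\<^esub> r \<otimes>\<^bsub>D\<^esub> s) \<otimes>\<^bsub>D\<^esub> r = \<one>\<^bsub>D\<^esub>"
    and "carrier D = {r [^]\<^bsub>D\<^esub> k |k. k < n} \<union> {r [^]\<^bsub>D\<^esub> k \<otimes>\<^bsub>D\<^esub> s |k. k < n}"
proof -
  have pow: "r [^]\<^bsub>D\<^esub> k = (int k mod int n, False)" for k :: nat
    unfolding D_def r_def by (rule dihedral_group_rotation_pow[OF assms(1)])
  show "r [^]\<^bsub>D\<^esub> n = \<one>\<^bsub>D\<^esub>" unfolding pow by (simp add: D_def dihedral_group_def)
  have mem: "x \<in> (\<lambda>k. (int k, b)) ` {..<n}"
    if "x \<in> {0..<int n} \<times> {b}" for x :: "int \<times> bool" and b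
    using that by (auto simp: image_iff intro!: bexI[of _ "nat (fst x)"])
  have "carrier D = (\<lambda>k. (int k, False)) ` {..<n} \<union> (\<lambda>k. (int k, True)) ` {..<n}"
    using mem by (fastforce simp: D_def dihedral_group_def)
  also have "(\<lambda>k. (int k, False)) ` {..<n} = {r [^]\<^bsub>D\<^esub> k |k. k < n}"
    unfolding pow by force
  also have "(\<lambda>k. (int k, True)) ` {..<n} = {r [^]\<^bsub>D\<^esub> k \<otimes>\<^bsub>D\<^esub> s |k. k < n}"
    unfolding pow by (force simp: D_def dihedral_group_def s_def)
  finally show "carrier D = {r [^]\<^bsub>D\<^esub> k |k. k < n} \<union> {r [^]\<^bsub>D\<^esub> k \<otimes>\<^bsub>D\<^esub> s |k. k < n}" .
qed (use assms(1) in \<open>auto simp: D_def r_def s_def dihedral_group_def mod_simps\<close>)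

end

theory Submission
  imports Defs
begin

text \<open>
  Two vertices of the non-commuting graph of the dihedral group are adjacent iff they lie in different
  classes of a partition (the non-central rotations, and the reflections \<open>r\<^sup>i s\<close> with \<open>i\<close> fixed
  modulo \<open>n / gcd n 2\<close>), so the graph is complete multipartite. If it has \<open>N\<close> vertices and parts \<open>C\<close>
  of size \<open>p C\<close>, then \<open>x I - L\<close> is the diagonal matrix with entries \<open>x - N + p C\<close>, minus the sum of the
  all-ones blocks on the parts, plus the all-ones matrix. For generic \<open>x\<close> its determinant follows by
  adding these rank-one matrices one at a time:
  \<open>(x - N) det (x I - L) = x \<Prod>C. (x - N) (x - (N - p C)) ^ (p C - 1)\<close>.
\<close>

section \<open>Determinants of low-rank updates\<close>

lemma det_one_add_mult_commute:
  fixes W V :: "'a :: idom mat"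
  assumes W: "W \<in> carrier_mat k m" and V: "V \<in> carrier_mat m k"
  shows "det (1\<^sub>m k + W * V) = det (1\<^sub>m m + V * W)"
proof -
  \<comment> \<open>Sylvester's identity: multiplying \<open>?M\<close> by the unimodular
    \<open>?E\<close> clears its upper right block. Multiplication from the left leaves
    \<open>1 + W V\<close> on the diagonal, from the right \<open>1 + V W\<close>, so both
    determinants equal \<open>det ?M\<close>.\<close>
  let ?M = "four_block_mat (1\<^sub>m k) (- W) V (1\<^sub>m m)"
  let ?E = "four_block_mat (1\<^sub>m k) W (0\<^sub>m m k) (1\<^sub>m m)"
  have M: "?M \<in> carrier_mat (k + m) (k + m)" and E: "?E \<in> carrier_mat (k + m) (k + m)"
    using W V by auto
  have E1: "det ?E = 1"
    using W by (subst det_four_block_mat_lower_left_zero[where n = k and m = m]) auto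
  have WV: "W * V \<in> carrier_mat k k" and VW: "V * W \<in> carrier_mat m m"
    using W V by auto
  have zero: "W + - W = 0\<^sub>m k m" "- W + W = 0\<^sub>m k m"
    using W by auto
  have "det ?M = det ?E * det ?M" by (simp add: E1)
  also have "\<dots> = det (?E * ?M)" by (rule det_mult[OF E M, symmetric])
  also have "?E * ?M = four_block_mat (1\<^sub>m k + W * V) (0\<^sub>m k m) V (1\<^sub>m m)"
    using W V WV zero
    by (subst mult_four_block_mat[of _ k k _ m _ m _ _ k _ m]) auto
  also have "det \<dots> = det (1\<^sub>m k + W * V)"
    using V WV by (subst det_four_block_mat_upper_right_zero[where n = k and m = m]) auto
  finally have left: "det ?M = det (1\<^sub>m k + W * V)" .
  have "det ?M = det ?M * det ?E" by (simp add: E1)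
  also have "\<dots> = det (?M * ?E)" by (rule det_mult[OF M E, symmetric])
  also have "?M * ?E = four_block_mat (1\<^sub>m k) (0\<^sub>m k m) V (1\<^sub>m m + V * W)"
    using W V VW zero
    by (subst mult_four_block_mat[of _ k k _ m _ m _ _ k _ m]) (auto simp: comm_add_mat[of _ m m])
  also have "det \<dots> = det (1\<^sub>m m + V * W)"
    using V VW by (subst det_four_block_mat_upper_right_zero[where n = k and m = m]) auto
  finally show ?thesis using left by simp
qed

text \<open>Given A w = u, the matrix A + u v^T factors as A (1 + w v^T), and
  \<open>det_one_add_mult_commute\<close> shrinks the second determinant to size 1. Supplying the
  solution \<open>w\<close> avoids inverting A.\<close>

lemma det_rank_one_update:
  fixes a :: "nat \<Rightarrow> nat \<Rightarrow> 'a :: idom"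
  assumes "\<And>i. i < k \<Longrightarrow> (\<Sum>j<k. a i j * w j) = u i"
  shows "det (mat k k (\<lambda>(i, j). a i j + u i * v j)) =
    det (mat k k (\<lambda>(i, j). a i j)) * (1 + (\<Sum>i<k. v i * w i))"
proof -
  let ?A = "mat k k (\<lambda>(i, j). a i j)"
  let ?W = "mat k 1 (\<lambda>(i, _). w i)" and ?V = "mat 1 k (\<lambda>(_, j). v j)"
  have "mat k k (\<lambda>(i, j). a i j + u i * v j) = ?A + (?A * ?W) * ?V"
    by (rule eq_matI) (auto simp: scalar_prod_def assms lessThan_atLeast0[symmetric])
  also have "\<dots> = ?A * (1\<^sub>m k + ?W * ?V)"
    by (subst mult_add_distrib_mat[of _ k k _ k]) (auto simp: assoc_mult_mat[of _ k k _ 1 _ k])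
  also have "det \<dots> = det ?A * det (1\<^sub>m k + ?W * ?V)"
    by (rule det_mult[of _ k]) auto
  also have "det (1\<^sub>m k + ?W * ?V) = det (1\<^sub>m 1 + ?V * ?W)"
    by (rule det_one_add_mult_commute) auto
  also have "\<dots> = 1 + (\<Sum>i<k. v i * w i)"
    by (subst det_single) (auto simp: scalar_prod_def lessThan_atLeast0[symmetric])
  finally show ?thesis .
qed

text \<open>The blocks are subtracted one class at a time, each as a rank-one update with
  \<open>u\<close> the indicator of the class and \<open>v = - u\<close>.\<close>

lemma det_diag_minus_blocks:
  fixes a :: "nat \<Rightarrow> 'a :: field" and c :: "nat \<Rightarrow> 'b"
  assumes "finite S" and a: "\<And>i. i < k \<Longrightarrow> a i \<noteq> 0"
  shows "det (mat k k (\<lambda>(i, j). (if i = j then a i else 0) - (if c i = c j \<and> c i \<in> S then 1 else 0))) =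
    (\<Prod>i<k. a i) * (\<Prod>C\<in>S. 1 - (\<Sum>i | i < k \<and> c i = C. 1 / a i))"
  using assms(1)
proof (induction S)
  case empty
  have "det (mat k k (\<lambda>(i, j). if i = j then a i else 0)) = (\<Prod>i<k. a i)"
    by (subst det_upper_triangular[of _ k])
      (auto simp: upper_triangular_def diag_mat_def prod.list_conv_set_nth lessThan_atLeast0)
  then show ?case by simp
next
  case (insert C S)
  let ?f = "\<lambda>S i j. (if i = j then a i else 0) - (if c i = c j \<and> c i \<in> S then 1 else 0 :: 'a)"
  let ?u = "\<lambda>i. if c i = C then 1 else 0 :: 'a"
  have "mat k k (\<lambda>(i, j). ?f (insert C S) i j) = mat k k (\<lambda>(i, j). ?f S i j + ?u i * - ?u j)"
    using insert.hyps by (intro eq_matI) auto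
  moreover have "det (mat k k (\<lambda>(i, j). ?f S i j + ?u i * - ?u j)) =
      det (mat k k (\<lambda>(i, j). ?f S i j)) * (1 + (\<Sum>i<k. - ?u i * (?u i / a i)))"
  proof (rule det_rank_one_update)
    fix i assume i: "i < k"
    \<comment> \<open>The blocks already subtracted do not meet the class \<open>C\<close>, so the
      matrix is still diagonal there and \<open>?u j / a j\<close> solves the system.\<close>
    have "(\<Sum>j<k. ?f S i j * (?u j / a j)) = (\<Sum>j<k. if i = j then ?u i else 0)"
      using insert.hyps a by (intro sum.cong) auto
    then show "(\<Sum>j<k. ?f S i j * (?u j / a j)) = ?u i" using i by simp
  qed
  moreover have "1 + (\<Sum>i<k. - ?u i * (?u i / a i)) = 1 - (\<Sum>i | i < k \<and> c i = C. 1 / a i)"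
  proof -
    have "(\<Sum>i<k. - ?u i * (?u i / a i)) = (\<Sum>i<k. if c i = C then - (1 / a i) else 0)"
      by (intro sum.cong) simp_all
    then show ?thesis by (simp add: sum.If_cases sum_negf Int_def)
  qed
  ultimately show ?case
    unfolding insert.IH prod.insert[OF insert.hyps] by (simp only: mult_ac)
qed

section \<open>Laplacian spectrum of a complete multipartite graph\<close>

lemma proots_linear_prod:
  "proots (\<Prod>C\<in>S. [:- a, 1:] * [:- b C, 1:] ^ m C) =
    (\<Sum>C\<in>S. add_mset a (replicate_mset (m C) (b C)))"
  by (subst proots_prod) (auto simp: proots_mult proots_power simp del: mult_pCons_left)

text \<open>The out-neighbours of \<open>x\<close> are the vertices outside its class. The additive
  form avoids subtraction of naturals when the degree is cast to the complex numbers.\<close>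

lemma out_degree_multipartite:
  assumes "finite (pverts \<Gamma>)" and x: "x \<in> pverts \<Gamma>"
    and arcs: "parcs \<Gamma> = {(x, y). x \<in> pverts \<Gamma> \<and> y \<in> pverts \<Gamma> \<and> c x \<noteq> c y}"
  shows "out_degree (with_proj \<Gamma>) x + card {y \<in> pverts \<Gamma>. c y = c x} = card (pverts \<Gamma>)"
proof -
  have "out_arcs (with_proj \<Gamma>) x = Pair x ` {y \<in> pverts \<Gamma>. c y \<noteq> c x}"
    using x by (auto simp: out_arcs_def arcs with_proj_def)
  then have "out_degree (with_proj \<Gamma>) x = card {y \<in> pverts \<Gamma>. c y \<noteq> c x}"
    by (simp add: out_degree_def card_image inj_on_def)
  moreover have "card (pverts \<Gamma>) = card ({y \<in> pverts \<Gamma>. c y \<noteq> c x} \<union> {y \<in> pverts \<Gamma>. c y = c x})"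
    by (rule arg_cong[of _ _ card]) blast
  ultimately show ?thesis
    using assms(1) by (simp, subst card_Un_disjoint) auto
qed

text \<open>Each part contributes a root N, and the final all-ones update replaces one of these by
  0. The extra N on the left records this replacement without a multiset subtraction.\<close>

lemma spec_laplacian_multipartite:
  fixes \<Gamma> :: "'a pair_pre_digraph" and c :: "'a \<Rightarrow> 'b"
  assumes vs: "vertex_enumeration \<Gamma> vs"
    and arcs: "parcs \<Gamma> = {(x, y). x \<in> pverts \<Gamma> \<and> y \<in> pverts \<Gamma> \<and> c x \<noteq> c y}"
  defines "N \<equiv> card (pverts \<Gamma>)" and "p \<equiv> (\<lambda>C. card {v \<in> pverts \<Gamma>. c v = C})"
  shows "add_mset (of_nat N) (spec (laplacian_mat \<Gamma> vs)) =
    add_mset 0 (\<Sum>C\<in>c ` pverts \<Gamma>.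
      add_mset (of_nat N) (replicate_mset (p C - 1) (of_nat N - of_nat (p C))))"
proof -
  let ?L = "map_mat complex_of_real (laplacian_mat \<Gamma> vs)"
  let ?S = "c ` pverts \<Gamma>"
  define d where "d = (\<lambda>i. c (vs ! i))"
  have dist: "distinct vs" and set: "set vs = pverts \<Gamma>"
    using vs by (auto simp: vertex_enumeration_def)
  have fin: "finite (pverts \<Gamma>)" using set by (metis finite_set)
  have len: "length vs = N" unfolding N_def using dist set by (metis distinct_card)
  have mem: "vs ! i \<in> pverts \<Gamma>" if "i < N" for i using that len set nth_mem by blast
  have bij: "bij_betw ((!) vs) {..<N} (pverts \<Gamma>)"
    using bij_betw_nth[OF dist, of "{..<N}" "pverts \<Gamma>"] len set by simp
  have card_class: "card {i. i < N \<and> d i = C} = p C" for C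
  proof -
    have "bij_betw ((!) vs) {i \<in> {..<N}. d i = C} {v \<in> pverts \<Gamma>. c v = C}"
      unfolding d_def by (rule bij_betw_Collect[OF bij]) simp
    then show ?thesis unfolding p_def by (auto dest: bij_betw_same_card)
  qed
  have p_pos: "p C > 0" if "C \<in> ?S" for C
    using that fin by (auto simp: p_def card_gt_0_iff)
  have dS: "d ` {..<N} = ?S"
    unfolding d_def using bij by (auto simp: bij_betw_def image_image[symmetric])
  have L: "?L $$ (i, j) = (if i = j then of_nat N - of_nat (p (d i)) else if d i = d j then 0 else -1)"
    if "i < N" "j < N" for i j
  proof (cases "i = j")
    case True
    have "out_degree (with_proj \<Gamma>) (vs ! i) + p (d i) = N"
      using out_degree_multipartite[OF fin mem[OF that(1)] arcs] by (simp add: d_def p_def N_def)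
    from arg_cong[OF this, of complex_of_nat]
    have "complex_of_nat N - of_nat (p (d i)) = of_nat (out_degree (with_proj \<Gamma>) (vs ! i))"
      by (simp add: algebra_simps)
    then show ?thesis using that True
      by (simp add: laplacian_mat_def degree_mat_def adjacency_mat_def len arcs)
  next
    case False
    then show ?thesis using that mem
      by (simp add: laplacian_mat_def degree_mat_def adjacency_mat_def len arcs d_def)
  qed
  have L_carrier: "?L \<in> carrier_mat N N"
    unfolding map_carrier_mat laplacian_mat_def adjacency_mat_def len
    by (intro minus_carrier_mat) simp
  \<comment> \<open>Excluding the values N - p C keeps the diagonal entries nonzero; excluding N
    allows division by x - N in the all-ones update.\<close>
  have char_poly_eval: "(x - of_nat N) * poly (char_poly ?L) x =
      x * (\<Prod>C\<in>?S. (x - of_nat N) * (x - (of_nat N - of_nat (p C))) ^ (p C - 1))"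
    if x: "x \<noteq> of_nat N" "\<forall>C\<in>?S. x \<noteq> of_nat N - of_nat (p C)" for x
  proof -
    define a where "a = (\<lambda>C. x - (of_nat N - of_nat (p C)))"
    let ?f = "\<lambda>i j. (if i = j then a (d i) else 0) - (if d i = d j \<and> d i \<in> ?S then 1 else 0)"
    have a: "a C \<noteq> 0" if "C \<in> ?S" for C using x that by (auto simp: a_def)
    have dmem: "d i \<in> ?S" if "i < N" for i using that dS by auto
    \<comment> \<open>The all-ones matrix is written \<open>1 * 1\<close> to match the pattern
      \<open>u i * v j\<close> of \<open>det_rank_one_update\<close>.\<close>
    have "poly (char_poly ?L) x = det (mat N N (\<lambda>(i, j). ?f i j + 1 * 1))"
      unfolding char_poly_matrix[OF L_carrier]
    proof (intro arg_cong[of _ _ det] eq_matI)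
      fix i j assume "i < dim_row (mat N N (\<lambda>(i, j). ?f i j + 1 * 1))"
        "j < dim_col (mat N N (\<lambda>(i, j). ?f i j + 1 * 1))"
      then have ij: "i < N" "j < N" by simp_all
      then have "(- char_matrix ?L x) $$ (i, j) = - (?L $$ (i, j) - (if i = j then x else 0))"
        using L_carrier unfolding char_matrix_def
        by (subst index_uminus_mat, auto simp del: index_map_mat(1))
      then show "(- char_matrix ?L x) $$ (i, j) = mat N N (\<lambda>(i, j). ?f i j + 1 * 1) $$ (i, j)"
        unfolding L[OF ij] using ij by (simp add: a_def dmem)
    qed (use L_carrier in \<open>auto simp: char_matrix_def\<close>)
    moreover have "det (mat N N (\<lambda>(i, j). ?f i j + 1 * 1)) =
        det (mat N N (\<lambda>(i, j). ?f i j)) * (1 + (\<Sum>i<N. 1 * (1 / (x - of_nat N))))"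
    proof (rule det_rank_one_update)
      fix i assume i: "i < N"
      \<comment> \<open>In each row the block removes exactly the part size contained in
        \<open>a (d i)\<close>, so all row sums are x - N and the constant vector 1 / (x - N) is the
        solution needed.\<close>
      have "(\<Sum>j<N. ?f i j) = a (d i) - (\<Sum>j<N. if d i = d j then 1 else 0)"
        using i dmem by (simp add: sum_subtractf)
      moreover have "(\<Sum>j<N. if d i = d j then 1 else 0) = (of_nat (p (d i)) :: complex)"
      proof -
        have "{..<N} \<inter> {j. d i = d j} = {j. j < N \<and> d j = d i}" by auto
        then show ?thesis unfolding card_class[symmetric] by (simp add: sum.If_cases)
      qed
      ultimately have "(\<Sum>j<N. ?f i j) = x - of_nat N" by (simp add: a_def)
      then show "(\<Sum>j<N. ?f i j * (1 / (x - of_nat N))) = 1"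
        using x by (simp flip: sum_divide_distrib)
    qed
    moreover have "1 + (\<Sum>i<N. 1 * (1 / (x - of_nat N))) = x / (x - of_nat N)"
      using x by (simp add: field_simps)
    moreover have "det (mat N N (\<lambda>(i, j). ?f i j)) =
        (\<Prod>i<N. a (d i)) * (\<Prod>C\<in>?S. 1 - (\<Sum>i | i < N \<and> d i = C. 1 / a (d i)))"
      using fin a dmem by (intro det_diag_minus_blocks) auto
    moreover have "(\<Prod>i<N. a (d i)) = (\<Prod>C\<in>?S. a C ^ p C)"
      using prod.image_gen[of "{..<N}" "\<lambda>i. a (d i)" d] by (simp add: dS card_class)
    moreover have "(\<Prod>C\<in>?S. a C ^ p C) * (\<Prod>C\<in>?S. 1 - (\<Sum>i | i < N \<and> d i = C. 1 / a (d i))) =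
        (\<Prod>C\<in>?S. (x - of_nat N) * a C ^ (p C - 1))"
      unfolding prod.distrib[symmetric]
    proof (rule prod.cong[OF refl])
      fix C assume C: "C \<in> ?S"
      \<comment> \<open>Parts are nonempty, so one factor \<open>a C\<close> can be split off; it
        turns 1 - p C / a C into a C - p C = x - N.\<close>
      have "a C ^ p C = a C * a C ^ (p C - 1)" using p_pos[OF C] by (simp flip: power_Suc)
      moreover have "a C * (1 - of_nat (p C) / a C) = x - of_nat N"
        using a[OF C] by (simp add: a_def right_diff_distrib)
      ultimately show "a C ^ p C * (1 - (\<Sum>i | i < N \<and> d i = C. 1 / a (d i))) =
          (x - of_nat N) * a C ^ (p C - 1)"
        by (simp add: card_class mult_ac)
    qed
    ultimately have "poly (char_poly ?L) x =
        (\<Prod>C\<in>?S. (x - of_nat N) * a C ^ (p C - 1)) * (x / (x - of_nat N))"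
      by argo
    then show ?thesis using x by (simp add: a_def)
  qed
  let ?R = "\<Prod>C\<in>?S. [:- of_nat N, 1:] * [:- (of_nat N - of_nat (p C)), 1:] ^ (p C - 1) :: complex poly"
  have "[:- of_nat N, 1:] * char_poly ?L = [:0, 1:] * ?R"
  \<comment> \<open>The two sides agree off a finite set of excluded points, while a nonzero
    difference would have only finitely many roots; the complex numbers are infinite.\<close>
  proof (rule ccontr)
    assume "\<not> ?thesis"
    then have "finite {x. poly ([:- of_nat N, 1:] * char_poly ?L - [:0, 1:] * ?R) x = 0}"
      by (intro poly_roots_finite) simp
    moreover have "- ({of_nat N} \<union> (\<lambda>C. of_nat N - of_nat (p C)) ` ?S) \<subseteq>
        {x. poly ([:- of_nat N, 1:] * char_poly ?L - [:0, 1:] * ?R) x = 0}"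
      using char_poly_eval by (auto simp: poly_prod image_iff algebra_simps)
    ultimately have "finite (- ({of_nat N} \<union> (\<lambda>C. of_nat N - of_nat (p C)) ` ?S) :: complex set)"
      by (rule rev_finite_subset)
    then show False using fin by (subst (asm) finite_compl) (auto simp: infinite_UNIV_char_0)
  qed
  moreover have "char_poly ?L \<noteq> 0" using degree_monic_char_poly[OF L_carrier] by auto
  moreover have "?R \<noteq> 0" using fin by (auto simp del: mult_pCons_left)
  ultimately have "proots [:- of_nat N, 1:] + proots (char_poly ?L) = proots [:0, 1:] + proots ?R"
    by (subst (1 2) proots_mult[symmetric]) (auto simp del: mult_pCons_left)
  then show ?thesis
    unfolding spec_def unfolding proots_linear_prod by simp
qed


section \<open>Specialization to the dihedral group\<close>

lemma sum_add_mset_replicate_mset: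
  assumes "finite S"
  shows "(\<Sum>x\<in>S. add_mset a (replicate_mset k b)) =
    replicate_mset (card S) a + replicate_mset (card S * k) b"
  using assms by induction (auto simp: multiset_eq_iff)

text \<open>The elements are j + m t with 0 \<le> t < e. This counts the central rotations (j = 0)
  and the reflections in one part.\<close>

lemma card_residue_class:
  assumes "0 \<le> j" "j < int m"
  shows "card {i \<in> {0..<int (m * e)}. i mod int m = j} = e"
proof -
  have "{i \<in> {0..<int (m * e)}. i mod int m = j} = (\<lambda>t. j + int m * t) ` {0..<int e}" (is "?A = ?B")
  proof (intro equalityI subsetI)
    fix i assume i: "i \<in> ?A"
    then have "i = j + int m * (i div int m)" by auto
    moreover have "0 \<le> i div int m" using i assms by (simp add: pos_imp_zdiv_nonneg_iff)
    moreover have "i div int m < int e"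
    proof -
      have "int m * (i div int m) \<le> i"
        using i assms mult_div_mod_eq[of "int m" i] by (simp del: mult_div_mod_eq)
      also have "i < int m * int e" using i by simp
      finally show ?thesis using assms by (subst (asm) mult_less_cancel_left_pos) auto
    qed
    ultimately show "i \<in> ?B" by auto
  next
    fix i assume "i \<in> ?B"
    then obtain t where t: "0 \<le> t" "t < int e" "i = j + int m * t" by auto
    \<comment> \<open>The bound e - 1, rather than e, leaves the room of m that is needed to add j <
      m.\<close>
    have "int m * t \<le> int m * (int e - 1)" using t by (intro mult_left_mono) auto
    then show "i \<in> ?A" using t assms by (auto simp: algebra_simps)
  qed
  also have "card \<dots> = e"
    using assms by (subst card_image) (auto simp: inj_on_def)
  finally show ?thesis .
qed

text \<open>The factor \<open>e\<close> is all that \<open>n\<close> shares with 2: it cancels for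
  even \<open>n\<close>, and for odd \<open>n\<close> the 2 is coprime to \<open>n\<close>.
  Commutation in the dihedral group yields conditions n | 2k, so this treats both parities at
  once.\<close>

lemma dvd_two_mult_iff:
  assumes "n = m * e" "gcd n 2 = e"
  shows "int n dvd 2 * k \<longleftrightarrow> int m dvd k"
proof (cases "even n")
  case True
  then have "e = 2" using assms by simp
  then show ?thesis using assms by simp
next
  case False
  then have "e = 1" using assms by (metis coprime_imp_gcd_eq_1 coprime_right_2_iff_odd)
  moreover have "coprime (int n) 2" using False by simp
  ultimately show ?thesis using assms by (simp add: coprime_dvd_mult_right_iff)
qed

text \<open>Here \<open>e\<close> is the order of the center. There are 2n - e vertices, in one part
  of n - e rotations and \<open>m\<close> parts of \<open>e\<close> reflections;
  \<open>m \<ge> 2\<close> excludes the abelian cases n = 1, 2.\<close>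

lemma spec_laplacian_dihedral:
  assumes n: "n = m * e" "gcd n 2 = e" and m: "m \<ge> 2"
    and vs: "vertex_enumeration (non_commuting_graph (dihedral_group n)) vs"
  shows "spec (laplacian_mat (non_commuting_graph (dihedral_group n)) vs) =
    add_mset 0 (replicate_mset (n - e - 1) (of_nat n) + replicate_mset m (2 * of_nat n - of_nat e) +
      replicate_mset (m * (e - 1)) (2 * of_nat n - 2 * of_nat e))"
proof -
  let ?G = "dihedral_group n" and ?V = "pverts (non_commuting_graph (dihedral_group n))"
  \<comment> \<open>The label -1 of the rotations cannot clash with a residue modulo
    \<open>m\<close>.\<close>
  define c where "c = (\<lambda>(i, b). if b then i mod int m else - 1)"
  have e: "e > 0" "e \<le> 2" using n(2) using gcd_le2_nat[of 2 n] by auto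
  \<comment> \<open>A rotation r^i commutes with a reflection iff n | 2i, and two reflections with
    exponents i, j commute iff n | 2(i - j); two rotations always commute.\<close>
  have commute: "(i, b) \<otimes>\<^bsub>?G\<^esub> (j, d) = (j, d) \<otimes>\<^bsub>?G\<^esub> (i, b) \<longleftrightarrow>
      (if b then if d then i mod int m = j mod int m else int m dvd j else d \<longrightarrow> int m dvd i)" for i b j d
  proof -
    have "(i + j) mod int n = (j - i) mod int n \<longleftrightarrow> int m dvd i" for i j
      unfolding mod_eq_dvd_iff dvd_two_mult_iff[OF n, symmetric] by (simp add: algebra_simps)
    note this[of i j] this[of j i]
    moreover have "(i - j) mod int n = (j - i) mod int n \<longleftrightarrow> i mod int m = j mod int m"
      unfolding mod_eq_dvd_iff dvd_two_mult_iff[OF n, symmetric] by (simp add: algebra_simps)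
    ultimately show ?thesis by (auto simp: dihedral_group_def add.commute)
  qed
  have carrier: "carrier ?G = {0..<int n} \<times> UNIV" by (simp add: dihedral_group_def)
  have "m \<le> n" using n e by simp
  then have n2: "n \<ge> 2" using m by simp
  have ndvd: "\<not> int m dvd 1" using m by simp
  have center: "center ?G = {i \<in> {0..<int n}. int m dvd i} \<times> {False}"
  proof -
    have "(i, True) \<notin> center ?G" for i
    proof
      assume "(i, True) \<in> center ?G"
      moreover have "(1, False) \<in> carrier ?G" using n2 by (simp add: carrier)
      ultimately have "(i, True) \<otimes>\<^bsub>?G\<^esub> (1, False) = (1, False) \<otimes>\<^bsub>?G\<^esub> (i, True)"
        unfolding center_def by blast
      then show False using ndvd by (simp add: commute)
    qed
    moreover have "(i, False) \<in> center ?G \<longleftrightarrow> i \<in> {0..<int n} \<and> int m dvd i" for i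
    proof -
      have "(0, True) \<in> carrier ?G" using n2 by (simp add: carrier)
      then show ?thesis unfolding center_def by (auto simp: commute carrier)
    qed
    ultimately show ?thesis by (auto split: prod.splits) (metis (full_types))+
  qed
  have V: "?V = ({0..<int n} - {i \<in> {0..<int n}. i mod int m = 0}) \<times> {False} \<union> {0..<int n} \<times> {True}"
    (is "_ = ?R \<times> _ \<union> _")
    by (auto simp: non_commuting_graph_def carrier center dvd_eq_mod_eq_0)
  have nneg: "i mod int m \<noteq> - 1" for i
    using m pos_mod_sign[of "int m" i] by linarith
  have arcs: "parcs (non_commuting_graph ?G) = {(x, y). x \<in> ?V \<and> y \<in> ?V \<and> c x \<noteq> c y}"
  proof -
    \<comment> \<open>A rotation vertex has exponent not divisible by \<open>m\<close>, so it
      commutes with no reflection, as the labels demand.\<close>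
    have "x \<otimes>\<^bsub>?G\<^esub> y \<noteq> y \<otimes>\<^bsub>?G\<^esub> x \<longleftrightarrow> c x \<noteq> c y" if "x \<in> ?V" "y \<in> ?V" for x y
      using that nneg nneg[symmetric] unfolding V
      by (cases x; cases y) (auto simp: commute c_def dvd_eq_mod_eq_0)
    then show ?thesis by (auto simp: non_commuting_graph_def)
  qed
  have card_R: "card ?R = n - e"
  proof -
    have "finite {i \<in> {0..<int n}. i mod int m = 0}"
      by (rule finite_subset[of _ "{0..<int n}"]) auto
    then show ?thesis
      using card_residue_class[of 0 m e] m by (subst card_Diff_subset) (auto simp flip: n(1))
  qed
  have card_V: "card ?V = 2 * n - e"
    unfolding V using \<open>m \<le> n\<close> e n2
    by (subst card_Un_disjoint) (auto simp: card_cartesian_product card_R[simplified])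
  have classes: "c ` ?V = insert (- 1) {0..<int m}"
  proof (intro equalityI subsetI)
    fix j assume j: "j \<in> insert (- 1) {0..<int m}"
    \<comment> \<open>Since \<open>m \<ge> 2\<close>, the generating rotation is non-central and
      realizes the label -1.\<close>
    have "c (1, False) = -1" "(1, False) \<in> ?V" using n2 m by (auto simp: c_def V)
    moreover have "c (j, True) = j" "(j, True) \<in> ?V" if "j \<in> {0..<int m}"
      using that \<open>m \<le> n\<close> by (auto simp: c_def V)
    ultimately show "j \<in> c ` ?V" using j by (metis imageI insertE)
  qed (use m in \<open>auto simp: V c_def\<close>)
  have card_rot: "card {v \<in> ?V. c v = - 1} = n - e"
  proof -
    have "{v \<in> ?V. c v = - 1} = ?R \<times> {False}"
      using nneg by (auto simp: V c_def split: if_splits)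
    then show ?thesis using card_R by (simp add: card_cartesian_product)
  qed
  have card_refl: "card {v \<in> ?V. c v = j} = e" if "j \<in> {0..<int m}" for j
  proof -
    have "{v \<in> ?V. c v = j} = {i \<in> {0..<int n}. i mod int m = j} \<times> {True}"
      using that by (auto simp: V c_def)
    then show ?thesis using that card_residue_class[of j m e]
      by (simp add: card_cartesian_product flip: n(1))
  qed
  have "e \<le> n" using n m by simp
  then have diff: "of_nat (2 * n - e) = (2 * of_nat n - of_nat e :: complex)"
    "2 * of_nat n - of_nat e - of_nat (n - e) = (of_nat n :: complex)"
    "2 * of_nat n - of_nat e - of_nat e = (2 * of_nat n - 2 * of_nat e :: complex)"
    by (auto simp: of_nat_diff)
  \<comment> \<open>The rotation part gives the eigenvalue (2n - e) - (n - e) = n, each reflection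
    part 2n - 2e. Every part also gives one 2n - e, of which one copy cancels.\<close>
  have "add_mset (2 * of_nat n - of_nat e) (spec (laplacian_mat (non_commuting_graph ?G) vs)) =
    add_mset 0 (add_mset (2 * of_nat n - of_nat e) (replicate_mset (n - e - 1) (of_nat n)) +
      (\<Sum>j\<in>{0..<int m}. add_mset (2 * of_nat n - of_nat e)
        (replicate_mset (e - 1) (2 * of_nat n - 2 * of_nat e))))"
    using spec_laplacian_multipartite[OF vs arcs]
    by (simp add: classes card_rot card_refl card_V diff)
  then show ?thesis
    by (simp add: sum_add_mset_replicate_mset ac_simps)
qed

theorem theorem2p5:
  fixes n :: nat and vs :: "(int \<times> bool) list"
  assumes "n \<ge> 3"
    and "vertex_enumeration (non_commuting_graph (dihedral_group n)) vs"
  shows "(even n \<and> n > 4 \<longrightarrow>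
      spec (laplacian_mat (non_commuting_graph (dihedral_group n)) vs) =
        replicate_mset (n div 2) (2 * of_nat n - 2) +
        replicate_mset (n div 2) (2 * of_nat n - 4) +
        replicate_mset (n - 3) (of_nat n) +
        replicate_mset 1 0) \<and>
    (odd n \<longrightarrow>
      spec (laplacian_mat (non_commuting_graph (dihedral_group n)) vs) =
        replicate_mset 1 0 +
        replicate_mset (n - 2) (of_nat n) +
        replicate_mset n (2 * of_nat n - 1)) \<and>
    (n = 4 \<longrightarrow>
      spec (laplacian_mat (non_commuting_graph (dihedral_group n)) vs) =
        replicate_mset 1 0 + replicate_mset 3 4 + replicate_mset 2 6)"
proof (cases "even n")
  case True
  then have "n = (n div 2) * 2" "gcd n 2 = 2" "n div 2 \<ge> 2"
    using assms(1) by (simp, simp add: gcd_nat.absorb2, presburger)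
  \<comment> \<open>Comparing counts also settles n = 4, where 2n - 4 and n coincide and their
    multiplicities 2 and 1 add up to 3.\<close>
  from spec_laplacian_dihedral[OF this assms(2)] True show ?thesis
    by (auto simp: multiset_eq_iff)
next
  case False
  then have "n = n * 1" "gcd n 2 = 1" "n \<ge> 2"
    using assms(1) by (simp, simp add: coprime_imp_gcd_eq_1, simp)
  \<comment> \<open>With e = 1 the reflection parts are singletons, so the third family of
    eigenvalues is empty.\<close>
  from spec_laplacian_dihedral[OF this assms(2)] False show ?thesis
    by (auto simp flip: numeral_2_eq_2)
qed

end
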